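(* Let $T_1,T_2$ be two towers all of whose levels are nonempty. Then $[T_1]$ and $[T_2]$ are asymorphic if and only if there is an admissible morphism $f\colon T_1(\alpha)\to T_2(\beta)$ (with domain all of $T_1(\alpha)$) for some pair of increasing sequences $\alpha,\beta\colon\mathbb N\to\mathbb N$.
   Context: $\mathbb N=\{1,2,\dots\}$; increasing means strictly increasing. In a partially ordered set, $\downarrow x=\{y:y\le x\}$, $\uparrow x=\{y:y\ge x\}$; a subset $A$ is a lower set if $\downarrow a\subset A$ for all $a\in A$. Tower: a partially ordered set $T$ such that (1) $T$ is well-founded (every nonempty subset has a minimal element); (2) any two elements $x,y$ have a smallest upper bound $\sup\{x,y\}$; (3) every $\uparrow x$ is linearly ordered; (4) for every $a\in T$ there is a finite number $lev_T(a)$ such that $|\uparrow x\cap\downarrow a|=lev_T(a)$ for every minimal element $x\in\downarrow a$ of $T$. The levels are $L_i=lev_T^{-1}(i)$, $i\in\mathbb N$. The base is $[T]=L_1$ (the set of minimal elements), with the ultrametric obtained by restricting the path metric $d_T(x,y)=2\,lev_T(\sup\{x,y\})-(lev_T(x)+lev_T(y))$. For $x\in T$, $pred(x)=L_{lev_T(x)-1}\cap\downarrow x$. Subtower: for an increasing $\alpha\colon\mathbb N\to\mathbb N$, $T(\alpha)$ is the subset $\bigcup_n L_{\alpha(n)}$ of $T$ with the induced order; its $n$-th level is $L_{\alpha(n)}$. Admissible morphism: a map $\phi\colon A\to T_2$ defined on a lower subset $A$ of a tower $T_1$, with $T_2$ a tower, such that (1) $lev(\phi(a))=lev(a)$ for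 all $a\in A$; (2) $a\le a'$ in $A$ implies $\phi(a)\le\phi(a')$; (3) $\phi(a)=\phi(a')$ with $a,a'\in A$ implies $a,a'\in pred(v)$ for some $v\in T_1$; (4) $\phi(A)$ is a lower subset of $T_2$; (5) $|\phi(\max A)|\le1$, where $\max A$ is the (possibly empty) set of maximal elements of $A$. For a map $T_1(\alpha)\to T_2(\beta)$ these notions (levels, pred) are taken in the towers $T_1(\alpha)$, $T_2(\beta)$. Asymorphic: a multi-map $\Phi\colon X\Rightarrow Y$ is a subset $\Phi\subset X\times Y$; $\Phi(A)=\{y:\exists a\in A,\ (a,y)\in\Phi\}$; it is surjective if $\Phi(X)=Y$; $\Phi^{-1}=\{(y,x):(x,y)\in\Phi\}$. It is bornologous (between metric spaces) if there is a non-decreasing $\varrho\colon[0,\infty)\to[0,\infty)$ with $\operatorname{diam}(\Phi(A))\le\varrho(\operatorname{diam}(A))$ for every bounded $A\subset X$. $X,Y$ are asymorphic if there is $\Phi$ such that $\Phi$ and $\Phi^{-1}$ are both surjective and bornologous. *)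

theory Defs
  imports
    Complex_Main
    "HOL-Library.Lub_Glb"
    "HOL-Library.Extended_Nonnegative_Real"
begin

text \<open>
  A partially ordered set is a subset \<open>T\<close> of a type of class \<open>order\<close>, with the induced order.
  All order-theoretic notions are relative to \<open>T\<close>, so a subset of a tower (such as a subtower)
  carries its own minimal elements, suprema, levels and so on.
\<close>

definition down_in :: "'a::order set \<Rightarrow> 'a \<Rightarrow> 'a set" where
  "down_in T x = {y \<in> T. y \<le> x}"

definition up_in :: "'a::order set \<Rightarrow> 'a \<Rightarrow> 'a set" where
  "up_in T x = {y \<in> T. x \<le> y}"

definition lower_subset :: "'a::order set \<Rightarrow> 'a set \<Rightarrow> bool" where
  "lower_subset T A \<longleftrightarrow> A \<subseteq> T \<and> (\<forall>a\<in>A. down_in T a \<subseteq> A)"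

definition minimals :: "'a::order set \<Rightarrow> 'a set" where
  "minimals S = {m \<in> S. \<forall>y\<in>S. y \<le> m \<longrightarrow> y = m}"

definition maximals :: "'a::order set \<Rightarrow> 'a set" where
  "maximals S = {m \<in> S. \<forall>y\<in>S. m \<le> y \<longrightarrow> y = m}"

definition has_lev :: "'a::order set \<Rightarrow> 'a \<Rightarrow> nat \<Rightarrow> bool" where
  "has_lev T a n \<longleftrightarrow>
     (\<forall>x \<in> minimals T \<inter> down_in T a.
        finite (up_in T x \<inter> down_in T a) \<and> card (up_in T x \<inter> down_in T a) = n)"

definition tower :: "'a::order set \<Rightarrow> bool" where
  "tower T \<longleftrightarrow>
     (\<forall>S. S \<subseteq> T \<and> S \<noteq> {} \<longrightarrow> minimals S \<noteq> {}) \<and>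
     (\<forall>x\<in>T. \<forall>y\<in>T. \<exists>s. isLub T {x, y} s) \<and>
     (\<forall>x\<in>T. \<forall>y\<in>up_in T x. \<forall>z\<in>up_in T x. y \<le> z \<or> z \<le> y) \<and>
     (\<forall>a\<in>T. \<exists>n. has_lev T a n)"

text \<open>
  In a tower the number \<open>n\<close> with \<open>has_lev T a n\<close> is unique, because well-foundedness provides a
  minimal element of \<open>T\<close> below \<open>a\<close>; it is at least 1.
\<close>

definition lev :: "'a::order set \<Rightarrow> 'a \<Rightarrow> nat" where
  "lev T a = (THE n. has_lev T a n)"

text \<open>The levels of a tower are indexed by the positive integers; its level 0 is empty.\<close>

definition level :: "'a::order set \<Rightarrow> nat \<Rightarrow> 'a set" where
  "level T i = {a \<in> T. lev T a = i}"

definition tower_base :: "'a::order set \<Rightarrow> 'a set" where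
  "tower_base T = level T 1"

definition tower_sup :: "'a::order set \<Rightarrow> 'a \<Rightarrow> 'a \<Rightarrow> 'a" where
  "tower_sup T x y = (THE s. isLub T {x, y} s)"

definition path_dist :: "'a::order set \<Rightarrow> 'a \<Rightarrow> 'a \<Rightarrow> real" where
  "path_dist T x y =
     2 * real (lev T (tower_sup T x y)) - (real (lev T x) + real (lev T y))"

text \<open>At the bottom level \<open>tower_pred T x\<close> is level 0, hence empty.\<close>

definition tower_pred :: "'a::order set \<Rightarrow> 'a \<Rightarrow> 'a set" where
  "tower_pred T x = level T (lev T x - 1) \<inter> down_in T x"

text \<open>
  An increasing sequence of positive integers indexed by the positive integers; the value of the
  function at 0 is irrelevant.
\<close>

definition increasing_seq :: "(nat \<Rightarrow> nat) \<Rightarrow> bool" where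
  "increasing_seq \<alpha> \<longleftrightarrow> (\<forall>n\<ge>1. 1 \<le> \<alpha> n) \<and> strict_mono_on {1..} \<alpha>"

definition subtower :: "'a::order set \<Rightarrow> (nat \<Rightarrow> nat) \<Rightarrow> 'a set" where
  "subtower T \<alpha> = (\<Union>n\<in>{1..}. level T (\<alpha> n))"

definition admissible_morphism ::
  "'a::order set \<Rightarrow> 'b::order set \<Rightarrow> 'a set \<Rightarrow> ('a \<Rightarrow> 'b) \<Rightarrow> bool" where
  "admissible_morphism T\<^sub>1 T\<^sub>2 A \<phi> \<longleftrightarrow>
     tower T\<^sub>1 \<and> tower T\<^sub>2 \<and> lower_subset T\<^sub>1 A \<and> \<phi> ` A \<subseteq> T\<^sub>2 \<and>
     (\<forall>a\<in>A. lev T\<^sub>2 (\<phi> a) = lev T\<^sub>1 a) \<and>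
     (\<forall>a\<in>A. \<forall>a'\<in>A. a \<le> a' \<longrightarrow> \<phi> a \<le> \<phi> a') \<and>
     (\<forall>a\<in>A. \<forall>a'\<in>A. \<phi> a = \<phi> a' \<longrightarrow>
        (\<exists>v\<in>T\<^sub>1. a \<in> tower_pred T\<^sub>1 v \<and> a' \<in> tower_pred T\<^sub>1 v)) \<and>
     lower_subset T\<^sub>2 (\<phi> ` A) \<and>
     finite (\<phi> ` maximals A) \<and> card (\<phi> ` maximals A) \<le> 1"

text \<open>
  Metric spaces are given by a carrier and a distance function. Diameters take values in
  \<open>[0,\<infinity>]\<close>, with \<open>diam d {} = 0\<close>.
\<close>

definition diam :: "('a \<Rightarrow> 'a \<Rightarrow> real) \<Rightarrow> 'a set \<Rightarrow> ennreal" where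
  "diam d A = (SUP (x, y) \<in> A \<times> A. ennreal (d x y))"

text \<open>
  A multi-map is a relation \<open>\<Phi> \<subseteq> X \<times> Y\<close>. In a bornologous multi-map bounded sets have bounded
  images, since the bound \<open>ennreal (\<rho> _)\<close> is finite.
\<close>

definition bornologous ::
  "'a set \<Rightarrow> ('a \<Rightarrow> 'a \<Rightarrow> real) \<Rightarrow> ('b \<Rightarrow> 'b \<Rightarrow> real) \<Rightarrow> ('a \<times> 'b) set \<Rightarrow> bool" where
  "bornologous X d\<^sub>X d\<^sub>Y \<Phi> \<longleftrightarrow>
     (\<exists>\<rho>::real \<Rightarrow> real. (\<forall>t\<ge>0. 0 \<le> \<rho> t) \<and> mono_on {0..} \<rho> \<and>
        (\<forall>A. A \<subseteq> X \<and> diam d\<^sub>X A < \<infinity> \<longrightarrow>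
           diam d\<^sub>Y (\<Phi> `` A) \<le> ennreal (\<rho> (enn2real (diam d\<^sub>X A)))))"

definition asymorphic ::
  "'a set \<Rightarrow> ('a \<Rightarrow> 'a \<Rightarrow> real) \<Rightarrow> 'b set \<Rightarrow> ('b \<Rightarrow> 'b \<Rightarrow> real) \<Rightarrow> bool" where
  "asymorphic X d\<^sub>X Y d\<^sub>Y \<longleftrightarrow>
     (\<exists>\<Phi>. \<Phi> \<subseteq> X \<times> Y \<and> \<Phi> `` X = Y \<and> \<Phi>\<inverse> `` Y = X \<and>
        bornologous X d\<^sub>X d\<^sub>Y \<Phi> \<and> bornologous Y d\<^sub>Y d\<^sub>X (\<Phi>\<inverse>))"

end

theory Submission
  imports Defs
begin

text \<open>
  Below an element of level \<open>k\<close> lies a set of base points, and for each \<open>k\<close> these sets partition the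
  base. Thus a tower with nonempty levels is a sequence of increasingly coarse equivalence relations
  on its base, any two points being eventually identified: \<open>x\<close> and \<open>x'\<close> are related at stage \<open>k\<close>
  if they have the same ancestor \<open>anc T k x = anc T k x'\<close> at level \<open>k\<close>. The classes at stage \<open>k\<close> are
  the closed balls of radius \<open>2 * (k - 1)\<close> (\<open>path_dist_le_iff\<close>), so a multi-map between the bases is
  bornologous iff for every stage \<open>i\<close> there is a stage \<open>j\<close> such that it sends classes of stage \<open>i\<close>
  into classes of stage \<open>j\<close> (\<open>bornologous_iff_merges\<close>). A subtower retains only the stages
  \<open>\<alpha> 1, \<alpha> 2, \<dots>\<close>, and its elements are the classes of these stages (\<open>tower_subtower\<close>,
  \<open>lev_subtower\<close>).

  Both implications link a multi-map \<open>\<Phi>\<close> and a morphism \<open>f\<close> by the identity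
  \<open>f (anc T\<^sub>1 (\<alpha> n) x) = anc T\<^sub>2 (\<beta> n) y\<close> for all \<open>(x, y) \<in> \<Phi>\<close> and \<open>n \<ge> 1\<close>. Given this identity,
  that \<open>f\<close> is a map on the \<open>n\<close>-th level means that \<open>\<Phi>\<close> sends classes of stage \<open>\<alpha> n\<close> into classes
  of stage \<open>\<beta> n\<close>; and that elements of the \<open>n\<close>-th level with the same value under \<open>f\<close> have the
  same parent means that \<open>\<Phi>\<inverse>\<close> sends classes of stage \<open>\<beta> n\<close> into classes of stage \<open>\<alpha> (n + 1)\<close>.
  Hence a morphism \<open>f\<close> gives an asymorphism, defined by the identity at \<open>n = 1\<close>; it relates every
  base point of \<open>T\<^sub>2\<close> to some point because \<open>f\<close> is onto (\<open>admissible_morphism_surj\<close>,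
  \<open>asymorphic_if_admissible_morphism\<close>). Conversely, given an asymorphism \<open>\<Phi>\<close>, choosing
  \<open>\<alpha> 1, \<beta> 1, \<alpha> 2, \<beta> 2, \<dots>\<close> one after the other, each large enough in terms of its
  predecessor, makes \<open>\<Phi>\<close> and \<open>\<Phi>\<inverse>\<close> satisfy these two conditions (\<open>alternating_sequences\<close>), and then
  the identity defines \<open>f\<close> (\<open>admissible_morphism_if_merges\<close>).
\<close>

section \<open>Levels in a tower\<close>

lemma minimal_below:
  assumes "tower T" "a \<in> T"
  obtains m where "m \<in> minimals T" "m \<le> a"
proof -
  have "down_in T a \<subseteq> T \<and> down_in T a \<noteq> {}"
    using assms(2) by (auto simp: down_in_def)
  then have "minimals (down_in T a) \<noteq> {}"
    using assms(1) unfolding tower_def by blast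
  then obtain m where "m \<in> minimals (down_in T a)" by blast
  then have "m \<in> minimals T" "m \<le> a"
    by (auto simp: minimals_def down_in_def intro: order_trans)
  then show ?thesis by (rule that)
qed

lemma minimals_subset: "m \<in> minimals T \<Longrightarrow> m \<in> T"
  by (simp add: minimals_def)

lemma lev_eqI:
  assumes "has_lev T a n" "m \<in> minimals T" "m \<le> a"
  shows "lev T a = n"
proof -
  have "m \<in> minimals T \<inter> down_in T a"
    using assms(2,3) by (auto simp: down_in_def minimals_def)
  then show ?thesis
    unfolding lev_def using assms(1) by (intro the_equality) (auto simp: has_lev_def)
qed

lemma card_chain_below:
  assumes "tower T" "a \<in> T" "m \<in> minimals T" "m \<le> a"
  shows "finite (up_in T m \<inter> down_in T a)" "card (up_in T m \<inter> down_in T a) = lev T a"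
proof -
  obtain n where n: "has_lev T a n" using assms(1,2) by (auto simp: tower_def)
  have "m \<in> minimals T \<inter> down_in T a"
    using assms(3,4) by (auto simp: down_in_def minimals_def)
  with n lev_eqI[OF n assms(3,4)]
  show "finite (up_in T m \<inter> down_in T a)" "card (up_in T m \<inter> down_in T a) = lev T a"
    by (auto simp: has_lev_def)
qed

lemma comparable_above:
  assumes "tower T" "x \<in> T" "a \<in> T" "b \<in> T" "x \<le> a" "x \<le> b"
  shows "a \<le> b \<or> b \<le> a"
  using assms unfolding tower_def up_in_def by blast

lemma lev_strict_mono:
  assumes "tower T" "a \<in> T" "b \<in> T" "a < b"
  shows "lev T a < lev T b"
proof -
  obtain m where m: "m \<in> minimals T" "m \<le> a" using minimal_below[OF assms(1,2)] .
  then have mb: "m \<le> b" using assms(4) by simp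
  have "up_in T m \<inter> down_in T a \<subset> up_in T m \<inter> down_in T b"
    using assms(3,4) mb by (force simp: up_in_def down_in_def)
  then have "card (up_in T m \<inter> down_in T a) < card (up_in T m \<inter> down_in T b)"
    by (rule psubset_card_mono[OF card_chain_below(1)[OF assms(1,3) m(1) mb]])
  then show ?thesis
    using card_chain_below(2)[OF assms(1,2) m] card_chain_below(2)[OF assms(1,3) m(1) mb] by simp
qed

lemma lev_mono: "tower T \<Longrightarrow> a \<in> T \<Longrightarrow> b \<in> T \<Longrightarrow> a \<le> b \<Longrightarrow> lev T a \<le> lev T b"
  using lev_strict_mono[of T a b] by (cases "a = b") (auto simp: order.order_iff_strict)

lemma le_if_lev_le_above:
  assumes "tower T" "x \<in> T" "a \<in> T" "b \<in> T" "x \<le> a" "x \<le> b" "lev T a \<le> lev T b"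
  shows "a \<le> b"
  using comparable_above[OF assms(1-6)] lev_strict_mono[of T b a] assms
  by (auto simp: order.order_iff_strict)

lemma eq_if_lev_eq_above:
  assumes "tower T" "x \<in> T" "a \<in> T" "b \<in> T" "x \<le> a" "x \<le> b" "lev T a = lev T b"
  shows "a = b"
  using le_if_lev_le_above[of T x a b] le_if_lev_le_above[of T x b a] assms by auto

lemma lev_ge_1:
  assumes "tower T" "a \<in> T"
  shows "1 \<le> lev T a"
proof -
  obtain m where m: "m \<in> minimals T" "m \<le> a" using minimal_below[OF assms] .
  have "a \<in> up_in T m \<inter> down_in T a" using assms(2) m by (simp add: up_in_def down_in_def)
  then show ?thesis
    using card_chain_below[OF assms m]
    by (metis One_nat_def Suc_leI card_gt_0_iff empty_iff)
qed

lemma tower_base_eq_minimals: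
  assumes "tower T"
  shows "tower_base T = minimals T"
proof (intro set_eqI iffI)
  fix a assume "a \<in> tower_base T"
  then have a: "a \<in> T" "lev T a = 1" by (auto simp: tower_base_def level_def)
  obtain m where m: "m \<in> minimals T" "m \<le> a" using minimal_below[OF assms a(1)] .
  have "m = a"
    using lev_strict_mono[OF assms minimals_subset[OF m(1)] a(1)]
      lev_ge_1[OF assms minimals_subset[OF m(1)]] a m(2) by (auto simp: order.order_iff_strict)
  then show "a \<in> minimals T" using m by simp
next
  fix a assume a: "a \<in> minimals T"
  have "up_in T a \<inter> down_in T a = {a}"
    using a by (auto simp: up_in_def down_in_def minimals_def)
  then have "lev T a = 1"
    using card_chain_below(2)[OF assms minimals_subset[OF a] a] by simp
  then show "a \<in> tower_base T"
    using minimals_subset[OF a] by (simp add: tower_base_def level_def)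
qed

lemma base_below:
  assumes "tower T" "a \<in> T"
  obtains m where "m \<in> tower_base T" "m \<le> a"
  using minimal_below[OF assms] tower_base_eq_minimals[OF assms(1)] by metis

lemma baseD: "m \<in> tower_base T \<Longrightarrow> m \<in> T" "m \<in> tower_base T \<Longrightarrow> lev T m = 1"
  by (simp_all add: tower_base_def level_def)

text \<open>
  A chain from the base up to \<open>b\<close> skips no level: it has exactly \<open>lev T b\<close> elements, and their
  levels are distinct numbers between \<open>1\<close> and \<open>lev T b\<close>.
\<close>

lemma interpolate_level:
  assumes "tower T" "x \<in> T" "b \<in> T" "x \<le> b" "lev T x \<le> k" "k \<le> lev T b"
  obtains a where "a \<in> T" "x \<le> a" "a \<le> b" "lev T a = k"
proof -
  obtain m where m: "m \<in> minimals T" "m \<le> x" using minimal_below[OF assms(1,2)] .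
  then have mT: "m \<in> T" and mb: "m \<le> b" using assms(4) minimals_subset by auto
  let ?C = "up_in T m \<inter> down_in T b"
  have fin: "finite ?C" and card: "card ?C = lev T b"
    using card_chain_below[OF assms(1,3) m(1) mb] by auto
  have "inj_on (lev T) ?C"
    by (rule inj_onI) (auto simp: up_in_def down_in_def intro: eq_if_lev_eq_above[OF assms(1) mT])
  then have "card (lev T ` ?C) = card {1..lev T b}" using card by (simp add: card_image)
  moreover have "lev T ` ?C \<subseteq> {1..lev T b}"
    using lev_ge_1[OF assms(1)] lev_mono[OF assms(1) _ assms(3)]
    by (auto simp: up_in_def down_in_def)
  ultimately have "lev T ` ?C = {1..lev T b}"
    by (intro card_subset_eq) auto
  moreover have "k \<in> {1..lev T b}"
    using assms(5,6) lev_ge_1[OF assms(1,2)] by simp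
  ultimately obtain a where a: "a \<in> ?C" "lev T a = k" by (metis imageE)
  then have "x \<le> a"
    using le_if_lev_le_above[OF assms(1) mT assms(2), of a] m(2) assms(5)
    by (auto simp: up_in_def down_in_def)
  then show ?thesis using a that by (auto simp: up_in_def down_in_def)
qed

section \<open>Ancestors in a tower with nonempty levels\<close>

definition tall_tower :: "'a::order set \<Rightarrow> bool" where
  "tall_tower T \<longleftrightarrow> tower T \<and> (\<forall>i\<ge>1. level T i \<noteq> {})"

lemma tall_towerD: "tall_tower T \<Longrightarrow> tower T"
  by (simp add: tall_tower_def)

definition anc :: "'a::order set \<Rightarrow> nat \<Rightarrow> 'a \<Rightarrow> 'a" where
  "anc T k x = (THE a. a \<in> T \<and> x \<le> a \<and> lev T a = k)"

lemma lub_exists: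
  assumes "tower T" "x \<in> T" "y \<in> T"
  obtains s where "isLub T {x, y} s"
  using assms unfolding tower_def by blast

lemma isLub_pair_iff:
  "isLub T {x, y} s \<longleftrightarrow> s \<in> T \<and> x \<le> s \<and> y \<le> s \<and> (\<forall>u\<in>T. x \<le> u \<and> y \<le> u \<longrightarrow> s \<le> u)"
  by (auto simp: isLub_def leastP_def isUb_def setle_def setge_def)

text \<open>
  An element \<open>c\<close> of level \<open>k\<close> need not be comparable with \<open>x\<close>, but \<open>sup {x, c}\<close> lies at level \<open>k\<close>
  or higher, so the chain from \<open>x\<close> to this supremum passes through level \<open>k\<close>.
\<close>

lemma ancestor_exists:
  assumes "tall_tower T" "x \<in> T" "lev T x \<le> k"
  obtains a where "a \<in> T" "x \<le> a" "lev T a = k"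
proof -
  have T: "tower T" using assms(1) by (rule tall_towerD)
  have "1 \<le> k" using lev_ge_1[OF T assms(2)] assms(3) by simp
  then obtain c where c: "c \<in> T" "lev T c = k"
    using assms(1) by (auto simp: tall_tower_def level_def)
  obtain s where s: "isLub T {x, c} s" using lub_exists[OF T assms(2) c(1)] .
  then have "s \<in> T" "x \<le> s" "k \<le> lev T s"
    using lev_mono[OF T c(1)] c(2) by (auto simp: isLub_pair_iff)
  then show ?thesis using interpolate_level[OF T assms(2) _ _ assms(3)] that by metis
qed

lemma anc_eqI:
  assumes "tower T" "x \<in> T" "a \<in> T" "x \<le> a" "lev T a = k"
  shows "anc T k x = a"
  unfolding anc_def using assms(3-5)
  by (intro the_equality) (auto intro: eq_if_lev_eq_above[OF assms(1,2)])

lemma anc: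
  assumes "tall_tower T" "x \<in> T" "lev T x \<le> k"
  shows "anc T k x \<in> T" "x \<le> anc T k x" "lev T (anc T k x) = k"
proof -
  obtain a where "a \<in> T" "x \<le> a" "lev T a = k" using ancestor_exists[OF assms] .
  moreover from this have "anc T k x = a"
    by (intro anc_eqI[OF tall_towerD[OF assms(1)] assms(2)])
  ultimately show "anc T k x \<in> T" "x \<le> anc T k x" "lev T (anc T k x) = k" by simp_all
qed

lemma anc_base:
  assumes "tall_tower T" "x \<in> tower_base T" "1 \<le> k"
  shows "anc T k x \<in> T" "x \<le> anc T k x" "lev T (anc T k x) = k"
  using anc[OF assms(1) baseD(1)[OF assms(2)]] baseD(2)[OF assms(2)] assms(3) by auto

lemma anc_mono:
  assumes "tall_tower T" "x \<in> tower_base T" "1 \<le> j" "j \<le> k"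
  shows "anc T j x \<le> anc T k x"
  using le_if_lev_le_above[OF tall_towerD[OF assms(1)] baseD(1)[OF assms(2)]]
    anc_base[OF assms(1,2)] assms(3,4) by simp

text \<open>Once two branches have merged, they stay merged.\<close>

lemma anc_eq_mono:
  assumes "tall_tower T" "x \<in> tower_base T" "y \<in> tower_base T" "1 \<le> j" "j \<le> k"
    and "anc T j x = anc T j y"
  shows "anc T k x = anc T k y"
proof -
  have "y \<le> anc T k x"
    using anc_base(2)[OF assms(1,3,4)] anc_mono[OF assms(1,2,4,5)] assms(6) by simp
  then show ?thesis
    using anc_eqI[OF tall_towerD[OF assms(1)] baseD(1)[OF assms(3)]] anc_base[OF assms(1,2)]
      assms(4,5) by (metis order_trans)
qed

lemma tower_sup_isLub:
  assumes "tower T" "x \<in> T" "y \<in> T"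
  shows "isLub T {x, y} (tower_sup T x y)"
proof -
  obtain s where s: "isLub T {x, y} s" using lub_exists[OF assms] .
  then have "tower_sup T x y = s"
    unfolding tower_sup_def by (intro the_equality) (auto simp: isLub_pair_iff intro: antisym)
  with s show ?thesis by simp
qed

lemma path_dist_commute: "path_dist T x y = path_dist T y x"
  by (simp add: path_dist_def tower_sup_def insert_commute)

text \<open>
  The balls of the ultrametric on the base are the sets of base points below a common element:
  two base points are within \<open>2 * (k - 1)\<close> iff their branches have merged at level \<open>k\<close>.
\<close>

lemma path_dist_le_iff:
  assumes "tall_tower T" "x \<in> tower_base T" "y \<in> tower_base T" "1 \<le> k"
  shows "path_dist T x y \<le> 2 * (real k - 1) \<longleftrightarrow> anc T k x = anc T k y"
proof -
  have T: "tower T" using assms(1) by (rule tall_towerD)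
  note x = baseD[OF assms(2)] and y = baseD[OF assms(3)]
  define s where "s = tower_sup T x y"
  have s: "s \<in> T" "x \<le> s" "y \<le> s" "\<And>u. u \<in> T \<Longrightarrow> x \<le> u \<Longrightarrow> y \<le> u \<Longrightarrow> s \<le> u"
    using tower_sup_isLub[OF T x(1) y(1)] by (auto simp: isLub_pair_iff s_def)
  have "path_dist T x y \<le> 2 * (real k - 1) \<longleftrightarrow> lev T s \<le> k"
    using x y by (auto simp: path_dist_def s_def)
  also have "\<dots> \<longleftrightarrow> anc T k x = anc T k y"
  proof
    assume "lev T s \<le> k"
    from anc[OF assms(1) s(1) this] show "anc T k x = anc T k y"
      using s(2,3) anc_eqI[OF T x(1)] anc_eqI[OF T y(1)] by (metis order_trans)
  next
    assume eq: "anc T k x = anc T k y"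
    then have "s \<le> anc T k x" using s(4) anc_base[OF assms(1)] assms(2-4) by metis
    then show "lev T s \<le> k"
      using lev_mono[OF T s(1)] anc_base[OF assms(1,2,4)] by metis
  qed
  finally show ?thesis .
qed

lemma path_dist_self:
  assumes "tall_tower T" "x \<in> tower_base T"
  shows "path_dist T x x \<le> 0"
  using path_dist_le_iff[OF assms(1,2,2), of 1] by simp

section \<open>Subtowers\<close>

lemma increasing_seqD:
  assumes "increasing_seq \<alpha>"
  shows "1 \<le> n \<Longrightarrow> 1 \<le> \<alpha> n"
    and "1 \<le> m \<Longrightarrow> 1 \<le> n \<Longrightarrow> \<alpha> m \<le> \<alpha> n \<longleftrightarrow> m \<le> n"
    and "1 \<le> m \<Longrightarrow> 1 \<le> n \<Longrightarrow> \<alpha> m = \<alpha> n \<longleftrightarrow> m = n"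
proof -
  have *: "strict_mono_on {1..} \<alpha>" using assms by (simp add: increasing_seq_def)
  show "1 \<le> n \<Longrightarrow> 1 \<le> \<alpha> n" using assms by (simp add: increasing_seq_def)
  show "1 \<le> m \<Longrightarrow> 1 \<le> n \<Longrightarrow> \<alpha> m \<le> \<alpha> n \<longleftrightarrow> m \<le> n"
    using strict_mono_on_less_eq[OF *] by simp
  show "1 \<le> m \<Longrightarrow> 1 \<le> n \<Longrightarrow> \<alpha> m = \<alpha> n \<longleftrightarrow> m = n"
    using strict_mono_on_eq[OF *] by simp
qed

lemma increasing_seq_ge:
  assumes "increasing_seq \<alpha>" "1 \<le> n"
  shows "n \<le> \<alpha> n"
  using assms(2)
proof (induction n rule: nat_induct_at_least)
  case base
  then show ?case using increasing_seqD(1)[OF assms(1)] by simp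
next
  case (Suc n)
  have "\<alpha> n < \<alpha> (Suc n)"
    using increasing_seqD(2)[OF assms(1), of "Suc n" n] Suc by simp
  with Suc show ?case by simp
qed

lemma mem_subtower: "a \<in> subtower T \<alpha> \<longleftrightarrow> a \<in> T \<and> (\<exists>n\<ge>1. lev T a = \<alpha> n)"
  by (auto simp: subtower_def level_def)

lemma minimals_subtower:
  assumes "tower T" "increasing_seq \<alpha>"
  shows "minimals (subtower T \<alpha>) = level T (\<alpha> 1)"
proof (intro set_eqI iffI)
  fix a assume a: "a \<in> minimals (subtower T \<alpha>)"
  then obtain n where n: "a \<in> T" "1 \<le> n" "lev T a = \<alpha> n"
    by (auto simp: minimals_def mem_subtower)
  obtain m where m: "m \<in> tower_base T" "m \<le> a" using base_below[OF assms(1) n(1)] .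
  have "lev T m \<le> \<alpha> 1" "\<alpha> 1 \<le> lev T a"
    using baseD(2)[OF m(1)] increasing_seqD(1,2)[OF assms(2)] n by auto
  then obtain b where b: "b \<in> T" "b \<le> a" "lev T b = \<alpha> 1"
    using interpolate_level[OF assms(1) baseD(1)[OF m(1)] n(1) m(2)] by metis
  then have "b \<in> subtower T \<alpha>" by (auto simp: mem_subtower)
  then have "b = a" using a b(2) by (auto simp: minimals_def)
  then show "a \<in> level T (\<alpha> 1)" using b by (simp add: level_def)
next
  fix a assume "a \<in> level T (\<alpha> 1)"
  then have a: "a \<in> T" "lev T a = \<alpha> 1" by (auto simp: level_def)
  have "b = a" if b: "b \<in> subtower T \<alpha>" "b \<le> a" for b
  proof -
    obtain n where n: "b \<in> T" "1 \<le> n" "lev T b = \<alpha> n" using b(1) by (auto simp: mem_subtower)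
    then have "lev T a \<le> lev T b" using a increasing_seqD(2)[OF assms(2)] by simp
    then show ?thesis using lev_strict_mono[OF assms(1) n(1) a(1)] b(2)
      by (auto simp: order.order_iff_strict)
  qed
  then show "a \<in> minimals (subtower T \<alpha>)" using a by (auto simp: minimals_def mem_subtower)
qed

text \<open>
  The chain from a minimal element \<open>x\<close> of the subtower to \<open>a\<close> meets exactly the levels
  \<open>\<alpha> 1, \<dots>, \<alpha> n\<close> of \<open>T\<close>, each in one element.
\<close>

lemma has_lev_subtower:
  assumes "tower T" "increasing_seq \<alpha>" "a \<in> T" "1 \<le> n" "lev T a = \<alpha> n"
  shows "has_lev (subtower T \<alpha>) a n"
  unfolding has_lev_def
proof
  let ?S = "subtower T \<alpha>"
  fix x assume "x \<in> minimals ?S \<inter> down_in ?S a"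
  then have x: "x \<in> T" "lev T x = \<alpha> 1" "x \<le> a"
    by (auto simp: minimals_subtower[OF assms(1,2)] level_def down_in_def)
  let ?C = "up_in ?S x \<inter> down_in ?S a"
  have inj: "inj_on (lev T) ?C"
    by (rule inj_onI)
      (auto simp: up_in_def down_in_def mem_subtower intro: eq_if_lev_eq_above[OF assms(1) x(1)])
  have img: "lev T ` ?C = \<alpha> ` {1..n}"
  proof (intro equalityI subsetI)
    fix k assume "k \<in> lev T ` ?C"
    then obtain b j where b: "b \<in> T" "b \<le> a" "1 \<le> j" "lev T b = \<alpha> j" "k = \<alpha> j"
      by (auto simp: up_in_def mem_subtower down_in_def)
    then have "j \<le> n"
      using lev_mono[OF assms(1) b(1) assms(3) b(2)] increasing_seqD(2)[OF assms(2)] assms(4,5)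
      by simp
    with b show "k \<in> \<alpha> ` {1..n}" by simp
  next
    fix k assume "k \<in> \<alpha> ` {1..n}"
    then obtain j where j: "1 \<le> j" "j \<le> n" "k = \<alpha> j" by auto
    then have "lev T x \<le> k" "k \<le> lev T a"
      using x(2) assms(4,5) increasing_seqD(2)[OF assms(2)] by auto
    then obtain b where "b \<in> T" "x \<le> b" "b \<le> a" "lev T b = k"
      using interpolate_level[OF assms(1) x(1) assms(3) x(3)] by metis
    moreover from this have "b \<in> ?S" using j by (auto simp: mem_subtower)
    ultimately show "k \<in> lev T ` ?C" by (auto simp: up_in_def down_in_def)
  qed
  have "inj_on \<alpha> {1..n}"
    by (rule inj_onI) (use increasing_seqD(3)[OF assms(2)] in auto)
  then have "card ?C = n" using card_image[OF inj] img by (simp add: card_image)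
  moreover have "finite ?C" using inj img finite_imageD[of "lev T" ?C] by simp
  ultimately show "finite ?C \<and> card ?C = n" by simp
qed

text \<open>
  The supremum of two elements in the subtower is the element that their supremum in \<open>T\<close> has above
  it at the first level of the form \<open>\<alpha> n\<close>.
\<close>

lemma tower_subtower:
  assumes "tall_tower T" "increasing_seq \<alpha>"
  shows "tower (subtower T \<alpha>)"
proof -
  let ?S = "subtower T \<alpha>"
  have T: "tower T" using assms(1) by (rule tall_towerD)
  have sub: "?S \<subseteq> T" by (auto simp: mem_subtower)
  have wf: "\<forall>S. S \<subseteq> ?S \<and> S \<noteq> {} \<longrightarrow> minimals S \<noteq> {}"
    using T sub unfolding tower_def by (meson order_trans)
  have lub: "\<exists>s. isLub ?S {x, y} s" if xy: "x \<in> ?S" "y \<in> ?S" for x y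
  proof -
    obtain s where "isLub T {x, y} s" using lub_exists[OF T] xy sub by blast
    then have s: "s \<in> T" "x \<le> s" "y \<le> s" "\<And>u. u \<in> T \<Longrightarrow> x \<le> u \<Longrightarrow> y \<le> u \<Longrightarrow> s \<le> u"
      by (auto simp: isLub_pair_iff)
    define n where "n = (LEAST n. 1 \<le> n \<and> lev T s \<le> \<alpha> n)"
    have "1 \<le> lev T s \<and> lev T s \<le> \<alpha> (lev T s)"
      using increasing_seq_ge[OF assms(2) lev_ge_1[OF T s(1)]] lev_ge_1[OF T s(1)] by simp
    then have n: "1 \<le> n" "lev T s \<le> \<alpha> n"
      unfolding n_def by (metis (mono_tags, lifting) LeastI)+
    note a = anc[OF assms(1) s(1) n(2)]
    have "anc T (\<alpha> n) s \<le> u" if u: "u \<in> ?S" "x \<le> u" "y \<le> u" for u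
    proof -
      obtain j where j: "u \<in> T" "1 \<le> j" "lev T u = \<alpha> j" using u(1) by (auto simp: mem_subtower)
      have su: "s \<le> u" using s(4) j u by blast
      then have "lev T s \<le> \<alpha> j" using lev_mono[OF T s(1) j(1)] j(3) by simp
      then have "n \<le> j" unfolding n_def using j(2) by (simp add: Least_le)
      then have "\<alpha> n \<le> \<alpha> j" using increasing_seqD(2)[OF assms(2) n(1) j(2)] by simp
      then show ?thesis using le_if_lev_le_above[OF T s(1) a(1) j(1) a(2) su] a(3) j(3) by simp
    qed
    then have "isLub ?S {x, y} (anc T (\<alpha> n) s)"
      using a n s by (auto simp: isLub_pair_iff mem_subtower intro: order_trans)
    then show ?thesis by blast
  qed
  have lin: "\<forall>x\<in>?S. \<forall>y\<in>up_in ?S x. \<forall>z\<in>up_in ?S x. y \<le> z \<or> z \<le> y"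
    using comparable_above[OF T] sub by (auto simp: up_in_def)
  have "\<forall>a\<in>?S. \<exists>n. has_lev ?S a n"
    using has_lev_subtower[OF T assms(2)] unfolding Ball_def mem_subtower by blast
  with wf lub lin show ?thesis unfolding tower_def by blast
qed

lemma lev_subtower:
  assumes "tall_tower T" "increasing_seq \<alpha>" "a \<in> T" "1 \<le> n" "lev T a = \<alpha> n"
  shows "lev (subtower T \<alpha>) a = n"
proof -
  have "a \<in> subtower T \<alpha>" using assms by (auto simp: mem_subtower)
  then obtain m where "m \<in> minimals (subtower T \<alpha>)" "m \<le> a"
    using minimal_below[OF tower_subtower[OF assms(1,2)]] by blast
  then show ?thesis
    using lev_eqI has_lev_subtower[OF tall_towerD[OF assms(1)] assms(2-5)] by metis
qed

lemma subtower_elem: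
  assumes "tall_tower T" "increasing_seq \<alpha>" "a \<in> subtower T \<alpha>"
  shows "a \<in> T" "1 \<le> lev (subtower T \<alpha>) a" "lev T a = \<alpha> (lev (subtower T \<alpha>) a)"
  using assms(3) lev_subtower[OF assms(1,2), of a] by (auto simp: mem_subtower)

lemma anc_subtower:
  assumes "tall_tower T" "increasing_seq \<alpha>" "x \<in> tower_base T" "1 \<le> n"
  shows "anc T (\<alpha> n) x \<in> subtower T \<alpha>" "lev (subtower T \<alpha>) (anc T (\<alpha> n) x) = n"
proof -
  note a = anc_base[OF assms(1,3) increasing_seqD(1)[OF assms(2,4)]]
  show "anc T (\<alpha> n) x \<in> subtower T \<alpha>" using a assms(4) by (auto simp: mem_subtower)
  show "lev (subtower T \<alpha>) (anc T (\<alpha> n) x) = n" using lev_subtower[OF assms(1,2) a(1) assms(4) a(3)] .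
qed

lemma subtower_elem_anc:
  assumes "tall_tower T" "increasing_seq \<alpha>" "a \<in> subtower T \<alpha>"
    and "x \<in> tower_base T" "x \<le> a" "lev (subtower T \<alpha>) a = n"
  shows "anc T (\<alpha> n) x = a"
  using anc_eqI[OF tall_towerD[OF assms(1)] baseD(1)[OF assms(4)]] subtower_elem[OF assms(1-3)]
    assms(5,6) by blast

text \<open>
  In \<open>tower_pred S v\<close> the level of \<open>v\<close> is determined by truncated subtraction; as \<open>n \<ge> 1\<close>, it is
  \<open>Suc n\<close>, so \<open>v\<close> is the element of level \<open>\<alpha> (Suc n)\<close> above both base points.
\<close>

lemma common_pred_iff:
  assumes "tall_tower T" "increasing_seq \<alpha>" "x \<in> tower_base T" "x' \<in> tower_base T" "1 \<le> n"
  defines "S \<equiv> subtower T \<alpha>"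
  shows "(\<exists>v\<in>S. anc T (\<alpha> n) x \<in> tower_pred S v \<and> anc T (\<alpha> n) x' \<in> tower_pred S v) \<longleftrightarrow>
    anc T (\<alpha> (Suc n)) x = anc T (\<alpha> (Suc n)) x'"
proof
  note a = anc_subtower[OF assms(1,2,3,5), folded S_def]
    and a' = anc_subtower[OF assms(1,2,4,5), folded S_def]
  have le: "x \<le> anc T (\<alpha> n) x" "x' \<le> anc T (\<alpha> n) x'"
    using anc_base(2)[OF assms(1)] assms(3,4) increasing_seqD(1)[OF assms(2,5)] by auto
  {
    assume "\<exists>v\<in>S. anc T (\<alpha> n) x \<in> tower_pred S v \<and> anc T (\<alpha> n) x' \<in> tower_pred S v"
    then obtain v where v: "v \<in> S" "n = lev S v - 1" "anc T (\<alpha> n) x \<le> v" "anc T (\<alpha> n) x' \<le> v"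
      using a(2) by (auto simp: tower_pred_def level_def down_in_def)
    then have "lev S v = Suc n" using assms(5) by simp
    then show "anc T (\<alpha> (Suc n)) x = anc T (\<alpha> (Suc n)) x'"
      using subtower_elem_anc[OF assms(1,2), folded S_def] v le assms(3,4)
      by (metis order_trans)
  next
    assume eq: "anc T (\<alpha> (Suc n)) x = anc T (\<alpha> (Suc n)) x'"
    let ?v = "anc T (\<alpha> (Suc n)) x"
    have v: "?v \<in> S" "lev S ?v = Suc n"
      using anc_subtower[OF assms(1-3), of "Suc n"] by (auto simp: S_def)
    have "anc T (\<alpha> n) x \<le> ?v" "anc T (\<alpha> n) x' \<le> ?v"
      using anc_mono[OF assms(1,3), of "\<alpha> n" "\<alpha> (Suc n)"]
        anc_mono[OF assms(1,4), of "\<alpha> n" "\<alpha> (Suc n)"]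
        assms(5) eq increasing_seqD(1,2)[OF assms(2)] by simp_all
    then show "\<exists>v\<in>S. anc T (\<alpha> n) x \<in> tower_pred S v \<and> anc T (\<alpha> n) x' \<in> tower_pred S v"
      using v a a' by (intro bexI[of _ ?v]) (auto simp: tower_pred_def level_def down_in_def)
  }
qed

section \<open>Bornologous multi-maps\<close>

lemma diam_ge: "x \<in> A \<Longrightarrow> y \<in> A \<Longrightarrow> ennreal (d x y) \<le> diam d A"
  unfolding diam_def by (rule SUP_upper2[of "(x, y)"]) auto

lemma diam_le: "(\<And>x y. x \<in> A \<Longrightarrow> y \<in> A \<Longrightarrow> ennreal (d x y) \<le> r) \<Longrightarrow> diam d A \<le> r"
  unfolding diam_def by (rule SUP_least) auto

text \<open>
  Boundedness of images need only be tested on pairs of points. The control function is the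
  supremum of the distances between images of points at distance at most \<open>t\<close>, together with \<open>0\<close>
  to keep it nonnegative and defined when there are no such points.
\<close>

lemma bornologous_iff_pairs:
  assumes "\<Phi> \<subseteq> X \<times> Y"
    and self: "\<And>x. x \<in> X \<Longrightarrow> d x x \<le> 0"
    and sym: "\<And>x x'. x \<in> X \<Longrightarrow> x' \<in> X \<Longrightarrow> d x x' = d x' x"
  shows "bornologous X d d' \<Phi> \<longleftrightarrow>
    (\<forall>r\<ge>0. \<exists>s. \<forall>(x, y)\<in>\<Phi>. \<forall>(x', y')\<in>\<Phi>. d x x' \<le> r \<longrightarrow> d' y y' \<le> s)"
    (is "_ \<longleftrightarrow> ?R")
proof
  assume "bornologous X d d' \<Phi>"
  then obtain \<rho> :: "real \<Rightarrow> real" where \<rho>: "\<forall>t\<ge>0. 0 \<le> \<rho> t" "mono_on {0..} \<rho>"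
    "\<And>A. A \<subseteq> X \<Longrightarrow> diam d A < \<infinity> \<Longrightarrow> diam d' (\<Phi> `` A) \<le> ennreal (\<rho> (enn2real (diam d A)))"
    by (auto simp: bornologous_def)
  have "d' y y' \<le> \<rho> r" if r: "0 \<le> r" "(x, y) \<in> \<Phi>" "(x', y') \<in> \<Phi>" "d x x' \<le> r" for r x y x' y'
  proof -
    let ?A = "{x, x'}"
    have A: "?A \<subseteq> X" using r assms(1) by auto
    have le: "diam d ?A \<le> ennreal r"
      using r A self[of x] self[of x'] sym[of x x'] by (intro diam_le) (auto intro!: ennreal_leI)
    then have fin: "diam d ?A < \<infinity>" by (rule le_less_trans) simp
    have "enn2real (diam d ?A) \<le> r" using le r(1) by (simp add: enn2real_leI)
    then have mono: "\<rho> (enn2real (diam d ?A)) \<le> \<rho> r"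
      using \<rho>(2) r(1) by (auto simp: mono_on_def)
    have "ennreal (d' y y') \<le> diam d' (\<Phi> `` ?A)" using r by (intro diam_ge) auto
    also have "\<dots> \<le> ennreal (\<rho> (enn2real (diam d ?A)))" using \<rho>(3)[OF A fin] .
    also have "\<dots> \<le> ennreal (\<rho> r)" using mono by (rule ennreal_leI)
    finally show ?thesis using \<rho>(1) r(1) by (simp add: ennreal_le_iff)
  qed
  then show ?R by blast
next
  assume R: ?R
  define D where "D t = insert 0 {d' y y' | x y x' y'. (x, y) \<in> \<Phi> \<and> (x', y') \<in> \<Phi> \<and> d x x' \<le> t}" for t
  have bdd: "bdd_above (D t)" if t: "0 \<le> t" for t
  proof -
    obtain s where "\<forall>(x, y)\<in>\<Phi>. \<forall>(x', y')\<in>\<Phi>. d x x' \<le> t \<longrightarrow> d' y y' \<le> s" using R t by blast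
    then have "z \<le> max s 0" if "z \<in> D t" for z using that by (fastforce simp: D_def)
    then show ?thesis by (rule bdd_aboveI)
  qed
  have "\<forall>t\<ge>0. 0 \<le> Sup (D t)" using bdd by (auto intro!: cSup_upper simp: D_def)
  moreover have "mono_on {0..} (\<lambda>t. Sup (D t))"
  proof (rule mono_onI)
    fix t u :: real assume "t \<in> {0..}" "u \<in> {0..}" "t \<le> u"
    moreover from this have "D t \<subseteq> D u" by (fastforce simp: D_def)
    ultimately show "Sup (D t) \<le> Sup (D u)" by (intro cSup_subset_mono bdd) (auto simp: D_def)
  qed
  moreover have "diam d' (\<Phi> `` A) \<le> ennreal (Sup (D (enn2real (diam d A))))"
    if A: "A \<subseteq> X" "diam d A < \<infinity>" for A
  proof (rule diam_le)
    fix y y' assume "y \<in> \<Phi> `` A" "y' \<in> \<Phi> `` A"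
    then obtain x x' where x: "x \<in> A" "x' \<in> A" "(x, y) \<in> \<Phi>" "(x', y') \<in> \<Phi>" by auto
    have "ennreal (d x x') \<le> ennreal (enn2real (diam d A))"
      using diam_ge[of x A x' d] x A by (auto simp: ennreal_enn2real_if)
    then have "d x x' \<le> enn2real (diam d A)" by (simp add: ennreal_le_iff)
    then have "d' y y' \<in> D (enn2real (diam d A))" using x by (auto simp: D_def)
    then show "ennreal (d' y y') \<le> ennreal (Sup (D (enn2real (diam d A))))"
      by (intro ennreal_leI cSup_upper bdd) auto
  qed
  ultimately show "bornologous X d d' \<Phi>"
    unfolding bornologous_def by (intro exI[of _ "\<lambda>t. Sup (D t)"]) auto
qed

definition merges :: "'a::order set \<Rightarrow> 'b::order set \<Rightarrow> ('a \<times> 'b) set \<Rightarrow> nat \<Rightarrow> nat \<Rightarrow> bool" where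
  "merges T\<^sub>1 T\<^sub>2 \<Phi> i j \<longleftrightarrow> (\<forall>(x, y)\<in>\<Phi>. \<forall>(x', y')\<in>\<Phi>.
     anc T\<^sub>1 i x = anc T\<^sub>1 i x' \<longrightarrow> anc T\<^sub>2 j y = anc T\<^sub>2 j y')"

lemma mergesD:
  assumes "merges T\<^sub>1 T\<^sub>2 \<Phi> i j" "(x, y) \<in> \<Phi>" "(x', y') \<in> \<Phi>" "anc T\<^sub>1 i x = anc T\<^sub>1 i x'"
  shows "anc T\<^sub>2 j y = anc T\<^sub>2 j y'"
  using assms by (auto simp: merges_def)

lemma merges_mono:
  assumes "tall_tower T\<^sub>2" "\<Phi> \<subseteq> X \<times> tower_base T\<^sub>2" "merges T\<^sub>1 T\<^sub>2 \<Phi> i j" "1 \<le> j" "j \<le> k"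
  shows "merges T\<^sub>1 T\<^sub>2 \<Phi> i k"
  unfolding merges_def
proof (clarify)
  fix x y x' y' assume *: "(x, y) \<in> \<Phi>" "(x', y') \<in> \<Phi>" "anc T\<^sub>1 i x = anc T\<^sub>1 i x'"
  then have "anc T\<^sub>2 j y = anc T\<^sub>2 j y'" using assms(3) by (auto simp: merges_def)
  then show "anc T\<^sub>2 k y = anc T\<^sub>2 k y'"
    using anc_eq_mono[OF assms(1) _ _ assms(4,5)] * assms(2) by blast
qed

text \<open>
  Classes of level \<open>k\<close> are the balls of radius \<open>2 * (k - 1)\<close>, and these radii are unbounded, so
  controlling diameters amounts to controlling merging levels.
\<close>

lemma bornologous_iff_merges:
  assumes "tall_tower T\<^sub>1" "tall_tower T\<^sub>2" "\<Phi> \<subseteq> tower_base T\<^sub>1 \<times> tower_base T\<^sub>2"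
  shows "bornologous (tower_base T\<^sub>1) (path_dist T\<^sub>1) (path_dist T\<^sub>2) \<Phi> \<longleftrightarrow>
    (\<forall>i\<ge>1. \<exists>j\<ge>1. merges T\<^sub>1 T\<^sub>2 \<Phi> i j)"
proof -
  note near = path_dist_le_iff[OF assms(1)] path_dist_le_iff[OF assms(2)]
  have round: "\<exists>k\<ge>1. r \<le> 2 * (real k - 1)" for r :: real
  proof -
    have "r \<le> real (nat \<lceil>r\<rceil>)" by (rule real_nat_ceiling_ge)
    then have "r \<le> 2 * (real (nat \<lceil>r\<rceil> + 1) - 1)" by simp
    then show ?thesis by (metis le_add2)
  qed
  have "bornologous (tower_base T\<^sub>1) (path_dist T\<^sub>1) (path_dist T\<^sub>2) \<Phi> \<longleftrightarrow>
    (\<forall>r\<ge>0. \<exists>s. \<forall>(x, y)\<in>\<Phi>. \<forall>(x', y')\<in>\<Phi>. path_dist T\<^sub>1 x x' \<le> r \<longrightarrow> path_dist T\<^sub>2 y y' \<le> s)"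
    by (rule bornologous_iff_pairs[OF assms(3)])
      (auto intro: path_dist_self[OF assms(1)] path_dist_commute)
  also have "\<dots> \<longleftrightarrow> (\<forall>i\<ge>1. \<exists>j\<ge>1. merges T\<^sub>1 T\<^sub>2 \<Phi> i j)"
  proof (intro iffI allI impI)
    fix i :: nat assume i: "1 \<le> i"
      and "\<forall>r\<ge>0. \<exists>s. \<forall>(x, y)\<in>\<Phi>. \<forall>(x', y')\<in>\<Phi>. path_dist T\<^sub>1 x x' \<le> r \<longrightarrow> path_dist T\<^sub>2 y y' \<le> s"
    moreover have "0 \<le> 2 * (real i - 1)" using i by simp
    ultimately obtain s where s: "\<forall>(x, y)\<in>\<Phi>. \<forall>(x', y')\<in>\<Phi>.
        path_dist T\<^sub>1 x x' \<le> 2 * (real i - 1) \<longrightarrow> path_dist T\<^sub>2 y y' \<le> s" by blast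
    obtain j where j: "1 \<le> j" "s \<le> 2 * (real j - 1)" using round by blast
    have "merges T\<^sub>1 T\<^sub>2 \<Phi> i j"
      unfolding merges_def
    proof clarify
      fix x y x' y' assume xy: "(x, y) \<in> \<Phi>" "(x', y') \<in> \<Phi>" and eq: "anc T\<^sub>1 i x = anc T\<^sub>1 i x'"
      have b: "x \<in> tower_base T\<^sub>1" "x' \<in> tower_base T\<^sub>1" "y \<in> tower_base T\<^sub>2" "y' \<in> tower_base T\<^sub>2"
        using xy assms(3) by auto
      have "path_dist T\<^sub>1 x x' \<le> 2 * (real i - 1)" using near(1)[OF b(1,2) i] eq by simp
      then have "path_dist T\<^sub>2 y y' \<le> s" using s xy by blast
      then have "path_dist T\<^sub>2 y y' \<le> 2 * (real j - 1)" using j by simp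
      then show "anc T\<^sub>2 j y = anc T\<^sub>2 j y'" using near(2)[OF b(3,4) j(1)] by simp
    qed
    then show "\<exists>j\<ge>1. merges T\<^sub>1 T\<^sub>2 \<Phi> i j" using j(1) by blast
  next
    fix r :: real assume m: "\<forall>i\<ge>1. \<exists>j\<ge>1. merges T\<^sub>1 T\<^sub>2 \<Phi> i j"
    obtain i where i: "1 \<le> i" "r \<le> 2 * (real i - 1)" using round by blast
    obtain j where j: "1 \<le> j" "merges T\<^sub>1 T\<^sub>2 \<Phi> i j" using m i(1) by blast
    have "path_dist T\<^sub>2 y y' \<le> 2 * (real j - 1)"
      if xy: "(x, y) \<in> \<Phi>" "(x', y') \<in> \<Phi>" and le: "path_dist T\<^sub>1 x x' \<le> r" for x y x' y'
    proof -
      have b: "x \<in> tower_base T\<^sub>1" "x' \<in> tower_base T\<^sub>1" "y \<in> tower_base T\<^sub>2" "y' \<in> tower_base T\<^sub>2"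
        using xy assms(3) by auto
      have "anc T\<^sub>1 i x = anc T\<^sub>1 i x'" using near(1)[OF b(1,2) i(1)] le i(2) by simp
      then have "anc T\<^sub>2 j y = anc T\<^sub>2 j y'" using j(2) xy by (auto simp: merges_def)
      then show ?thesis using near(2)[OF b(3,4) j(1)] by simp
    qed
    then show "\<exists>s. \<forall>(x, y)\<in>\<Phi>. \<forall>(x', y')\<in>\<Phi>. path_dist T\<^sub>1 x x' \<le> r \<longrightarrow> path_dist T\<^sub>2 y y' \<le> s"
      by blast
  qed
  finally show ?thesis .
qed

section \<open>From an admissible morphism to an asymorphism\<close>

text \<open>
  The image is a lower set which contains elements above every given \<open>y\<close>: any branch in the image
  eventually merges with the branch of \<open>y\<close>.
\<close>

lemma admissible_morphism_surj:
  assumes "tall_tower T\<^sub>1" "tall_tower T\<^sub>2" "increasing_seq \<alpha>" "increasing_seq \<beta>"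
    and f: "admissible_morphism (subtower T\<^sub>1 \<alpha>) (subtower T\<^sub>2 \<beta>) (subtower T\<^sub>1 \<alpha>) f"
  shows "f ` subtower T\<^sub>1 \<alpha> = subtower T\<^sub>2 \<beta>"
proof
  let ?S1 = "subtower T\<^sub>1 \<alpha>" and ?S2 = "subtower T\<^sub>2 \<beta>"
  show "f ` ?S1 \<subseteq> ?S2" using f by (simp add: admissible_morphism_def)
  show "?S2 \<subseteq> f ` ?S1"
  proof
    fix b assume b: "b \<in> ?S2"
    have S2: "tower ?S2" using tower_subtower[OF assms(2,4)] .
    obtain c where "c \<in> T\<^sub>1" using assms(1) by (force simp: tall_tower_def level_def)
    then obtain x where x: "x \<in> tower_base T\<^sub>1" using base_below[OF tall_towerD[OF assms(1)]] by blast
    note a = anc_subtower[OF assms(1,3) x]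
    let ?fx = "\<lambda>n. f (anc T\<^sub>1 (\<alpha> n) x)"
    have fx: "?fx n \<in> ?S2" "lev ?S2 (?fx n) = n" if "1 \<le> n" for n
      using f a[OF that] by (auto simp: admissible_morphism_def)
    obtain s where "isLub ?S2 {?fx 1, b} s" using lub_exists[OF S2 fx(1) b] by blast
    then have s: "s \<in> ?S2" "?fx 1 \<le> s" "b \<le> s" by (auto simp: isLub_pair_iff)
    define n where "n = lev ?S2 s"
    have n: "1 \<le> n" unfolding n_def using lev_ge_1[OF S2 s(1)] .
    have "anc T\<^sub>1 (\<alpha> 1) x \<le> anc T\<^sub>1 (\<alpha> n) x"
      using anc_mono[OF assms(1) x] increasing_seqD[OF assms(3)] n by simp
    then have "?fx 1 \<le> ?fx n" using f a(1)[of 1] a(1)[OF n] by (auto simp: admissible_morphism_def)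
    then have "?fx n = s"
      using eq_if_lev_eq_above[OF S2 fx(1)[of 1] fx(1)[OF n] s(1)] s(2) fx(2)[OF n] n_def by simp
    then have "s \<in> f ` ?S1" using a(1)[OF n] by blast
    moreover have "lower_subset ?S2 (f ` ?S1)" using f by (simp add: admissible_morphism_def)
    ultimately show "b \<in> f ` ?S1" using b s(3) by (auto simp: lower_subset_def down_in_def)
  qed
qed

text \<open>
  The multi-map relates \<open>x\<close> to \<open>y\<close> when \<open>f\<close> sends the ancestor of \<open>x\<close> in the base of the first
  subtower to that of \<open>y\<close> in the base of the second. Monotonicity spreads this equality to all
  levels, so \<open>f\<close> bounds the merging level of images. Since elements with equal values have the same
  parent, the merging level of preimages is bounded too, at the cost of one further level.
\<close>

lemma asymorphic_if_admissible_morphism: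
  assumes "tall_tower T\<^sub>1" "tall_tower T\<^sub>2" "increasing_seq \<alpha>" "increasing_seq \<beta>"
    and f: "admissible_morphism (subtower T\<^sub>1 \<alpha>) (subtower T\<^sub>2 \<beta>) (subtower T\<^sub>1 \<alpha>) f"
  shows "asymorphic (tower_base T\<^sub>1) (path_dist T\<^sub>1) (tower_base T\<^sub>2) (path_dist T\<^sub>2)"
proof -
  let ?S1 = "subtower T\<^sub>1 \<alpha>" and ?S2 = "subtower T\<^sub>2 \<beta>"
  note T1 = tall_towerD[OF assms(1)] and T2 = tall_towerD[OF assms(2)]
  define \<Phi> where "\<Phi> = {(x, y). x \<in> tower_base T\<^sub>1 \<and> y \<in> tower_base T\<^sub>2 \<and>
    f (anc T\<^sub>1 (\<alpha> 1) x) = anc T\<^sub>2 (\<beta> 1) y}"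
  have sub: "\<Phi> \<subseteq> tower_base T\<^sub>1 \<times> tower_base T\<^sub>2" by (auto simp: \<Phi>_def)
  then have sub': "\<Phi>\<inverse> \<subseteq> tower_base T\<^sub>2 \<times> tower_base T\<^sub>1" by auto
  have fS: "f a \<in> ?S2" "lev ?S2 (f a) = lev ?S1 a" if "a \<in> ?S1" for a
    using f that by (auto simp: admissible_morphism_def)
  have left_total: "\<exists>y. (x, y) \<in> \<Phi>" if x: "x \<in> tower_base T\<^sub>1" for x
  proof -
    let ?a = "anc T\<^sub>1 (\<alpha> 1) x"
    note a = anc_subtower[OF assms(1,3) x, of 1, simplified]
    have fa: "f ?a \<in> ?S2" "lev ?S2 (f ?a) = 1" using fS[of ?a] a by auto
    obtain y where y: "y \<in> tower_base T\<^sub>2" "y \<le> f ?a"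
      using base_below[OF T2] subtower_elem(1)[OF assms(2,4) fa(1)] by blast
    have "anc T\<^sub>2 (\<beta> 1) y = f ?a" using subtower_elem_anc[OF assms(2,4) fa(1) y fa(2)] .
    then show ?thesis using x y by (auto simp: \<Phi>_def)
  qed
  have right_total: "\<exists>x. (x, y) \<in> \<Phi>" if y: "y \<in> tower_base T\<^sub>2" for y
  proof -
    note b = anc_subtower[OF assms(2,4) y, of 1, simplified]
    then obtain a where a: "a \<in> ?S1" "f a = anc T\<^sub>2 (\<beta> 1) y"
      using admissible_morphism_surj[OF assms] by (metis imageE One_nat_def)
    have lev: "lev ?S1 a = 1" using fS(2)[OF a(1)] a(2) b by simp
    obtain x where x: "x \<in> tower_base T\<^sub>1" "x \<le> a"
      using base_below[OF T1] subtower_elem(1)[OF assms(1,3) a(1)] by blast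
    have "anc T\<^sub>1 (\<alpha> 1) x = a" using subtower_elem_anc[OF assms(1,3) a(1) x lev] .
    then show ?thesis using x y a by (auto simp: \<Phi>_def)
  qed
  have f_anc: "f (anc T\<^sub>1 (\<alpha> n) x) = anc T\<^sub>2 (\<beta> n) y" if xy: "(x, y) \<in> \<Phi>" and n: "1 \<le> n" for x y n
  proof -
    have x: "x \<in> tower_base T\<^sub>1" and y: "y \<in> tower_base T\<^sub>2"
      and e: "f (anc T\<^sub>1 (\<alpha> 1) x) = anc T\<^sub>2 (\<beta> 1) y" using xy by (auto simp: \<Phi>_def)
    note a = anc_subtower[OF assms(1,3) x]
    have "anc T\<^sub>1 (\<alpha> 1) x \<le> anc T\<^sub>1 (\<alpha> n) x"
      using anc_mono[OF assms(1) x] increasing_seqD[OF assms(3)] n by simp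
    then have "f (anc T\<^sub>1 (\<alpha> 1) x) \<le> f (anc T\<^sub>1 (\<alpha> n) x)"
      using f a(1)[of 1] a(1)[OF n] by (auto simp: admissible_morphism_def)
    then have "y \<le> f (anc T\<^sub>1 (\<alpha> n) x)"
      using e anc_base(2)[OF assms(2) y increasing_seqD(1)[OF assms(4)], of 1] by simp
    then show ?thesis
      using subtower_elem_anc[OF assms(2,4) _ y] fS[OF a(1)[OF n]] a(2)[OF n] by simp
  qed
  \<comment> \<open>Branches that agree at level \<open>i\<close> agree at level \<open>\<alpha> i \<ge> i\<close>, where \<open>f\<close> can be applied.\<close>
  have fwd: "merges T\<^sub>1 T\<^sub>2 \<Phi> i (\<beta> i)" if i: "1 \<le> i" for i
    unfolding merges_def
  proof clarify
    fix x y x' y' assume xy: "(x, y) \<in> \<Phi>" "(x', y') \<in> \<Phi>" and eq: "anc T\<^sub>1 i x = anc T\<^sub>1 i x'"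
    have "anc T\<^sub>1 (\<alpha> i) x = anc T\<^sub>1 (\<alpha> i) x'"
      using anc_eq_mono[OF assms(1) _ _ i increasing_seq_ge[OF assms(3) i] eq] xy sub by blast
    then show "anc T\<^sub>2 (\<beta> i) y = anc T\<^sub>2 (\<beta> i) y'" using f_anc[OF xy(1) i] f_anc[OF xy(2) i] by simp
  qed
  have bwd: "merges T\<^sub>2 T\<^sub>1 (\<Phi>\<inverse>) i (\<alpha> (Suc i))" if i: "1 \<le> i" for i
    unfolding merges_def
  proof clarify
    fix y x y' x' assume xy: "(x, y) \<in> \<Phi>" "(x', y') \<in> \<Phi>" and eq: "anc T\<^sub>2 i y = anc T\<^sub>2 i y'"
    have b: "x \<in> tower_base T\<^sub>1" "x' \<in> tower_base T\<^sub>1" using xy sub by auto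
    have "anc T\<^sub>2 (\<beta> i) y = anc T\<^sub>2 (\<beta> i) y'"
      using anc_eq_mono[OF assms(2) _ _ i increasing_seq_ge[OF assms(4) i] eq] xy sub by blast
    then have "f (anc T\<^sub>1 (\<alpha> i) x) = f (anc T\<^sub>1 (\<alpha> i) x')"
      using f_anc[OF xy(1) i] f_anc[OF xy(2) i] by simp
    then have "\<exists>v\<in>?S1. anc T\<^sub>1 (\<alpha> i) x \<in> tower_pred ?S1 v \<and> anc T\<^sub>1 (\<alpha> i) x' \<in> tower_pred ?S1 v"
      using f anc_subtower(1)[OF assms(1,3) b(1) i] anc_subtower(1)[OF assms(1,3) b(2) i]
      unfolding admissible_morphism_def by blast
    then show "anc T\<^sub>1 (\<alpha> (Suc i)) x = anc T\<^sub>1 (\<alpha> (Suc i)) x'"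
      using common_pred_iff[OF assms(1,3) b i] by simp
  qed
  have "bornologous (tower_base T\<^sub>1) (path_dist T\<^sub>1) (path_dist T\<^sub>2) \<Phi>"
    using bornologous_iff_merges[OF assms(1,2) sub] fwd increasing_seqD(1)[OF assms(4)] by blast
  moreover have "bornologous (tower_base T\<^sub>2) (path_dist T\<^sub>2) (path_dist T\<^sub>1) (\<Phi>\<inverse>)"
    using bornologous_iff_merges[OF assms(2,1) sub'] bwd increasing_seqD(1)[OF assms(3)]
    by (meson le_SucI)
  moreover have "\<Phi> `` tower_base T\<^sub>1 = tower_base T\<^sub>2" "\<Phi>\<inverse> `` tower_base T\<^sub>2 = tower_base T\<^sub>1"
    using left_total right_total sub by blast+
  ultimately show ?thesis unfolding asymorphic_def using sub by blast
qed

section \<open>From an asymorphism to an admissible morphism\<close>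

text \<open>
  With \<open>P\<close> and \<open>Q\<close> closed under enlarging the second argument, each new term of either sequence can be
  taken both large enough for the relation with the term chosen just before and larger than the
  preceding term of its own sequence. The recursion runs over the pairs \<open>(\<alpha> n, \<beta> n)\<close>.
\<close>

lemma alternating_sequences:
  assumes P: "\<And>i. 1 \<le> i \<Longrightarrow> \<exists>j\<ge>1. P i j" and P_mono: "\<And>i j k. P i j \<Longrightarrow> 1 \<le> j \<Longrightarrow> j \<le> k \<Longrightarrow> P i k"
    and Q: "\<And>j. 1 \<le> j \<Longrightarrow> \<exists>i\<ge>1. Q j i" and Q_mono: "\<And>j i k. Q j i \<Longrightarrow> 1 \<le> i \<Longrightarrow> i \<le> k \<Longrightarrow> Q j k"
  obtains \<alpha> \<beta> :: "nat \<Rightarrow> nat" where "increasing_seq \<alpha>" "increasing_seq \<beta>"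
    "\<And>n. 1 \<le> n \<Longrightarrow> P (\<alpha> n) (\<beta> n)" "\<And>n. 1 \<le> n \<Longrightarrow> Q (\<beta> n) (\<alpha> (Suc n))"
proof -
  have "\<exists>s. \<forall>n. (1 \<le> fst (s n) \<and> 1 \<le> snd (s n) \<and> P (fst (s n)) (snd (s n))) \<and>
      (fst (s n) < fst (s (Suc n)) \<and> snd (s n) < snd (s (Suc n)) \<and> Q (snd (s n)) (fst (s (Suc n))))"
  proof (rule dependent_nat_choice)
    show "\<exists>s. 1 \<le> fst s \<and> 1 \<le> snd s \<and> P (fst s) (snd s)" using P[of 1] by auto
  next
    fix s :: "nat \<times> nat" and n :: nat
    assume s: "1 \<le> fst s \<and> 1 \<le> snd s \<and> P (fst s) (snd s)"
    obtain i where i: "1 \<le> i" "Q (snd s) i" using Q s by blast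
    define a where "a = max i (Suc (fst s))"
    have a: "fst s < a" "1 \<le> a" "Q (snd s) a"
      using i Q_mono[OF i(2,1), of a] by (auto simp: a_def)
    obtain j where j: "1 \<le> j" "P a j" using P a(2) by blast
    define b where "b = max j (Suc (snd s))"
    have "snd s < b" "1 \<le> b" "P a b" using j P_mono[OF j(2,1), of b] by (auto simp: b_def)
    with a show "\<exists>t. (1 \<le> fst t \<and> 1 \<le> snd t \<and> P (fst t) (snd t)) \<and>
        (fst s < fst t \<and> snd s < snd t \<and> Q (snd s) (fst t))"
      by (intro exI[of _ "(a, b)"]) simp
  qed
  then obtain s :: "nat \<Rightarrow> nat \<times> nat" where s:
    "\<And>n. 1 \<le> fst (s n)" "\<And>n. 1 \<le> snd (s n)" "\<And>n. P (fst (s n)) (snd (s n))"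
    "\<And>n. fst (s n) < fst (s (Suc n))" "\<And>n. snd (s n) < snd (s (Suc n))"
    "\<And>n. Q (snd (s n)) (fst (s (Suc n)))" by blast
  have inc: "increasing_seq (\<lambda>n. g (s (n - 1)))"
    if "\<And>n. 1 \<le> g (s n)" "\<And>n. g (s n) < g (s (Suc n))" for g :: "nat \<times> nat \<Rightarrow> nat"
  proof -
    have "strict_mono (\<lambda>n. g (s n))" using that(2) by (simp add: strict_mono_Suc_iff)
    then have "strict_mono_on {1..} (\<lambda>n. g (s (n - 1)))"
      by (intro strict_mono_onI) (auto intro!: strict_monoD[of "\<lambda>n. g (s n)"])
    then show ?thesis using that(1) by (simp add: increasing_seq_def)
  qed
  show ?thesis
  proof (rule that)
    show "increasing_seq (\<lambda>n. fst (s (n - 1)))" "increasing_seq (\<lambda>n. snd (s (n - 1)))"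
      using inc s by auto
    show "P (fst (s (n - 1))) (snd (s (n - 1)))" for n using s(3) .
    show "Q (snd (s (n - 1))) (fst (s (Suc n - 1)))" if "1 \<le> n" for n
      using s(6)[of "n - 1"] that by simp
  qed
qed

text \<open>
  If \<open>\<Phi>\<close> respects the levels \<open>\<alpha> n\<close> and \<open>\<beta> n\<close>, the element of level \<open>\<beta> n\<close> above \<open>y\<close> depends only on
  the element of level \<open>\<alpha> n\<close> above \<open>x\<close> whenever \<open>(x, y) \<in> \<Phi>\<close>. The resulting map is monotone since
  one pair \<open>(x, y)\<close> computes its values along the whole branch of \<open>x\<close>. That \<open>\<Phi>\<inverse>\<close> respects the
  levels \<open>\<beta> n\<close> and \<open>\<alpha> (Suc n)\<close> says that elements with equal values have the same parent.
\<close>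

lemma admissible_morphism_if_merges:
  assumes "tall_tower T\<^sub>1" "tall_tower T\<^sub>2" "increasing_seq \<alpha>" "increasing_seq \<beta>"
    and \<Phi>: "\<Phi> \<subseteq> tower_base T\<^sub>1 \<times> tower_base T\<^sub>2"
      "\<Phi> `` tower_base T\<^sub>1 = tower_base T\<^sub>2" "\<Phi>\<inverse> `` tower_base T\<^sub>2 = tower_base T\<^sub>1"
    and fwd: "\<And>n. 1 \<le> n \<Longrightarrow> merges T\<^sub>1 T\<^sub>2 \<Phi> (\<alpha> n) (\<beta> n)"
    and bwd: "\<And>n. 1 \<le> n \<Longrightarrow> merges T\<^sub>2 T\<^sub>1 (\<Phi>\<inverse>) (\<beta> n) (\<alpha> (Suc n))"
  shows "\<exists>f. admissible_morphism (subtower T\<^sub>1 \<alpha>) (subtower T\<^sub>2 \<beta>) (subtower T\<^sub>1 \<alpha>) f"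
proof -
  let ?S1 = "subtower T\<^sub>1 \<alpha>" and ?S2 = "subtower T\<^sub>2 \<beta>"
  note T1 = tall_towerD[OF assms(1)] and T2 = tall_towerD[OF assms(2)]
  note S1 = tower_subtower[OF assms(1,3)] and S2 = tower_subtower[OF assms(2,4)]
  have base: "x \<in> tower_base T\<^sub>1" "y \<in> tower_base T\<^sub>2" if "(x, y) \<in> \<Phi>" for x y using that \<Phi>(1) by auto
  have below1: "\<exists>x y. (x, y) \<in> \<Phi> \<and> x \<le> a \<and> anc T\<^sub>1 (\<alpha> (lev ?S1 a)) x = a \<and> 1 \<le> lev ?S1 a"
    if a: "a \<in> ?S1" for a
  proof -
    note e = subtower_elem[OF assms(1,3) a]
    obtain x where x: "x \<in> tower_base T\<^sub>1" "x \<le> a" using base_below[OF T1 e(1)] .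
    then obtain y where "(x, y) \<in> \<Phi>" using \<Phi>(3) by blast
    then show ?thesis using x e subtower_elem_anc[OF assms(1,3) a x] by blast
  qed
  have below2: "\<exists>x y. (x, y) \<in> \<Phi> \<and> anc T\<^sub>2 (\<beta> (lev ?S2 b)) y = b \<and> 1 \<le> lev ?S2 b"
    if b: "b \<in> ?S2" for b
  proof -
    note e = subtower_elem[OF assms(2,4) b]
    obtain y where y: "y \<in> tower_base T\<^sub>2" "y \<le> b" using base_below[OF T2 e(1)] .
    then obtain x where "(x, y) \<in> \<Phi>" using \<Phi>(2) by blast
    then show ?thesis using e subtower_elem_anc[OF assms(2,4) b y] by blast
  qed
  \<comment> \<open>The choice of \<open>y\<close> does not affect the value, by \<open>fwd\<close>; this is \<open>f_anc\<close> below.\<close>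
  define f where "f a = anc T\<^sub>2 (\<beta> (lev ?S1 a)) (SOME y. \<exists>x. (x, y) \<in> \<Phi> \<and> x \<le> a)" for a
  have f_anc: "f (anc T\<^sub>1 (\<alpha> n) x) = anc T\<^sub>2 (\<beta> n) y" if xy: "(x, y) \<in> \<Phi>" and n: "1 \<le> n" for x y n
  proof -
    let ?a = "anc T\<^sub>1 (\<alpha> n) x"
    note a = anc_subtower[OF assms(1,3) base(1)[OF xy] n]
    define y' where "y' = (SOME y. \<exists>x. (x, y) \<in> \<Phi> \<and> x \<le> ?a)"
    have "\<exists>x'. (x', y') \<in> \<Phi> \<and> x' \<le> ?a"
      unfolding y'_def by (rule someI_ex) (use below1[OF a(1)] in blast)
    then obtain x' where x': "(x', y') \<in> \<Phi>" "x' \<le> ?a" by blast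
    have "anc T\<^sub>1 (\<alpha> n) x' = ?a" using subtower_elem_anc[OF assms(1,3) a(1) base(1)[OF x'(1)] x'(2) a(2)] .
    then have "anc T\<^sub>2 (\<beta> n) y' = anc T\<^sub>2 (\<beta> n) y"
      using fwd[OF n] xy x'(1) by (auto simp: merges_def)
    then show ?thesis using a(2) by (simp add: f_def y'_def)
  qed
  have f_lev: "f a \<in> ?S2" "lev ?S2 (f a) = lev ?S1 a" if "a \<in> ?S1" for a
    using below1[OF that] f_anc anc_subtower[OF assms(2,4)] base(2) by metis+
  have surj: "f ` ?S1 = ?S2"
  proof (intro equalityI subsetI)
    show "b \<in> ?S2" if "b \<in> f ` ?S1" for b using that f_lev(1) by blast
    show "b \<in> f ` ?S1" if "b \<in> ?S2" for b
      using below2[OF that] f_anc anc_subtower(1)[OF assms(1,3)] base(1) by (metis imageI)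
  qed
  have mono: "f a \<le> f a'" if a: "a \<in> ?S1" "a' \<in> ?S1" "a \<le> a'" for a a'
  proof -
    obtain x y where xy: "(x, y) \<in> \<Phi>" "x \<le> a" "anc T\<^sub>1 (\<alpha> (lev ?S1 a)) x = a" "1 \<le> lev ?S1 a"
      using below1[OF a(1)] by blast
    have "anc T\<^sub>1 (\<alpha> (lev ?S1 a')) x = a'"
      using subtower_elem_anc[OF assms(1,3) a(2) base(1)[OF xy(1)]] xy(2) a(3) by simp
    moreover have le: "lev ?S1 a \<le> lev ?S1 a'" using lev_mono[OF S1 a] .
    ultimately have "f a = anc T\<^sub>2 (\<beta> (lev ?S1 a)) y" "f a' = anc T\<^sub>2 (\<beta> (lev ?S1 a')) y"
      using f_anc[OF xy(1), of "lev ?S1 a"] f_anc[OF xy(1), of "lev ?S1 a'"] xy(3,4) by simp_all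
    then show ?thesis
      using anc_mono[OF assms(2) base(2)[OF xy(1)]] increasing_seqD[OF assms(4)] le xy(4) by simp
  qed
  have glue: "\<exists>v\<in>?S1. a \<in> tower_pred ?S1 v \<and> a' \<in> tower_pred ?S1 v"
    if a: "a \<in> ?S1" "a' \<in> ?S1" and eq: "f a = f a'" for a a'
  proof -
    define n where "n = lev ?S1 a"
    have n': "lev ?S1 a' = n" using f_lev(2)[OF a(1)] f_lev(2)[OF a(2)] eq n_def by simp
    obtain x y where xy: "(x, y) \<in> \<Phi>" "anc T\<^sub>1 (\<alpha> n) x = a" "1 \<le> n"
      using below1[OF a(1)] n_def by blast
    obtain x' y' where xy': "(x', y') \<in> \<Phi>" "anc T\<^sub>1 (\<alpha> n) x' = a'"
      using below1[OF a(2)] n' by blast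
    have "anc T\<^sub>2 (\<beta> n) y = anc T\<^sub>2 (\<beta> n) y'"
      using f_anc[OF xy(1,3)] f_anc[OF xy'(1) xy(3)] xy(2) xy'(2) eq by simp
    then have "anc T\<^sub>1 (\<alpha> (Suc n)) x = anc T\<^sub>1 (\<alpha> (Suc n)) x'"
      using mergesD[OF bwd[OF xy(3)]] xy(1) xy'(1) by blast
    then show ?thesis
      using common_pred_iff[OF assms(1,3) base(1)[OF xy(1)] base(1)[OF xy'(1)] xy(3)] xy(2) xy'(2)
      by simp
  qed
  have "maximals ?S1 = {}"
  proof (rule ccontr)
    assume "maximals ?S1 \<noteq> {}"
    then obtain a where a: "a \<in> ?S1" "\<And>b. b \<in> ?S1 \<Longrightarrow> a \<le> b \<Longrightarrow> b = a" by (auto simp: maximals_def)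
    obtain x y where xy: "(x, y) \<in> \<Phi>" "anc T\<^sub>1 (\<alpha> (lev ?S1 a)) x = a" "1 \<le> lev ?S1 a"
      using below1[OF a(1)] by blast
    let ?n = "lev ?S1 a"
    have "a \<le> anc T\<^sub>1 (\<alpha> (Suc ?n)) x"
      using anc_mono[OF assms(1) base(1)[OF xy(1)], of "\<alpha> ?n" "\<alpha> (Suc ?n)"]
        increasing_seqD[OF assms(3)] xy(2,3) by simp
    then have "anc T\<^sub>1 (\<alpha> (Suc ?n)) x = a"
      using a(2) anc_subtower(1)[OF assms(1,3) base(1)[OF xy(1)], of "Suc ?n"] by simp
    then show False
      using anc_subtower(2)[OF assms(1,3) base(1)[OF xy(1)], of "Suc ?n"] by simp
  qed
  moreover have "lower_subset ?S1 ?S1" "lower_subset ?S2 ?S2"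
    by (auto simp: lower_subset_def down_in_def)
  ultimately have "admissible_morphism ?S1 ?S2 ?S1 f"
    unfolding admissible_morphism_def using S1 S2 surj f_lev(2) mono glue by simp
  then show ?thesis by blast
qed

section \<open>The characterization\<close>

theorem corollary6p5:
  fixes T\<^sub>1 :: "'a::order set" and T\<^sub>2 :: "'b::order set"
  assumes "tower T\<^sub>1" and "tower T\<^sub>2"
    and "\<forall>i\<ge>1. level T\<^sub>1 i \<noteq> {}" and "\<forall>i\<ge>1. level T\<^sub>2 i \<noteq> {}"
  shows "asymorphic (tower_base T\<^sub>1) (path_dist T\<^sub>1) (tower_base T\<^sub>2) (path_dist T\<^sub>2) \<longleftrightarrow>
    (\<exists>\<alpha> \<beta> f. increasing_seq \<alpha> \<and> increasing_seq \<beta> \<and>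
       admissible_morphism (subtower T\<^sub>1 \<alpha>) (subtower T\<^sub>2 \<beta>) (subtower T\<^sub>1 \<alpha>) f)"
proof
  have t1: "tall_tower T\<^sub>1" and t2: "tall_tower T\<^sub>2" using assms by (simp_all add: tall_tower_def)
  {
    assume "\<exists>\<alpha> \<beta> f. increasing_seq \<alpha> \<and> increasing_seq \<beta> \<and>
      admissible_morphism (subtower T\<^sub>1 \<alpha>) (subtower T\<^sub>2 \<beta>) (subtower T\<^sub>1 \<alpha>) f"
    then show "asymorphic (tower_base T\<^sub>1) (path_dist T\<^sub>1) (tower_base T\<^sub>2) (path_dist T\<^sub>2)"
      using asymorphic_if_admissible_morphism[OF t1 t2] by blast
  next
    assume "asymorphic (tower_base T\<^sub>1) (path_dist T\<^sub>1) (tower_base T\<^sub>2) (path_dist T\<^sub>2)"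
    then obtain \<Phi> where \<Phi>: "\<Phi> \<subseteq> tower_base T\<^sub>1 \<times> tower_base T\<^sub>2"
      "\<Phi> `` tower_base T\<^sub>1 = tower_base T\<^sub>2" "\<Phi>\<inverse> `` tower_base T\<^sub>2 = tower_base T\<^sub>1"
      and born: "bornologous (tower_base T\<^sub>1) (path_dist T\<^sub>1) (path_dist T\<^sub>2) \<Phi>"
        "bornologous (tower_base T\<^sub>2) (path_dist T\<^sub>2) (path_dist T\<^sub>1) (\<Phi>\<inverse>)"
      unfolding asymorphic_def by blast
    have \<Phi>': "\<Phi>\<inverse> \<subseteq> tower_base T\<^sub>2 \<times> tower_base T\<^sub>1" using \<Phi>(1) by auto
    obtain \<alpha> \<beta> where "increasing_seq \<alpha>" "increasing_seq \<beta>"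
      "\<And>n. 1 \<le> n \<Longrightarrow> merges T\<^sub>1 T\<^sub>2 \<Phi> (\<alpha> n) (\<beta> n)"
      "\<And>n. 1 \<le> n \<Longrightarrow> merges T\<^sub>2 T\<^sub>1 (\<Phi>\<inverse>) (\<beta> n) (\<alpha> (Suc n))"
    proof (rule alternating_sequences[of "merges T\<^sub>1 T\<^sub>2 \<Phi>" "merges T\<^sub>2 T\<^sub>1 (\<Phi>\<inverse>)"])
      show "\<exists>j\<ge>1. merges T\<^sub>1 T\<^sub>2 \<Phi> i j" if "1 \<le> i" for i
        using born(1) bornologous_iff_merges[OF t1 t2 \<Phi>(1)] that by blast
      show "\<exists>i\<ge>1. merges T\<^sub>2 T\<^sub>1 (\<Phi>\<inverse>) j i" if "1 \<le> j" for j
        using born(2) bornologous_iff_merges[OF t2 t1 \<Phi>'] that by blast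
    qed (use merges_mono[OF t2 \<Phi>(1)] merges_mono[OF t1 \<Phi>'] in blast)+
    then show "\<exists>\<alpha> \<beta> f. increasing_seq \<alpha> \<and> increasing_seq \<beta> \<and>
      admissible_morphism (subtower T\<^sub>1 \<alpha>) (subtower T\<^sub>2 \<beta>) (subtower T\<^sub>1 \<alpha>) f"
      using admissible_morphism_if_merges[OF t1 t2 _ _ \<Phi>] by blast
  }
qed

end
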